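(* For any integer $n\geqslant 2$ one has $$\sup\left\{\frac{S(K)}{|K|^{\frac1n}\max_{\xi\in S^{n-1}}S(K\cap\xi^{\perp})}: K \text{ is a centrally symmetric convex body in } \mathbb{R}^n\right\}=+\infty .$$
   Context: A convex body in $\mathbb{R}^n$ is a compact convex set with non-empty interior; it is centrally symmetric if $x\in K$ implies $-x\in K$. $|\cdot|$ denotes volume in the appropriate dimension, $S^{n-1}$ is the Euclidean unit sphere, and $\xi^\perp=\{x\in\mathbb{R}^n:\langle x,\xi\rangle=0\}$. $S(A)$ denotes the surface area of a convex body $A$ in its appropriate dimension: if $A$ is a convex body in an $m$-dimensional Euclidean space $E$ with unit ball $B_E$, then $S(A)=\lim_{t\to0^+}\frac{|A+tB_E|-|A|}{t}$ ($m$-dimensional volume); so $S(K\cap \xi^\perp)$ is the surface area of $K\cap\xi^\perp$ computed in the $(n-1)$-dimensional space $\xi^\perp$ (when $n=2$ it equals $2$). *)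

theory Defs
  imports "HOL-Analysis.Analysis"
begin

definition symmetric_convex_body :: "'a::euclidean_space set \<Rightarrow> bool" where
  "symmetric_convex_body K \<longleftrightarrow>
     compact K \<and> convex K \<and> interior K \<noteq> {} \<and> (\<forall>x\<in>K. - x \<in> K)"

definition perp :: "'a::euclidean_space \<Rightarrow> 'a set" where
  "perp \<xi> = {x. x \<bullet> \<xi> = 0}"

definition orthonormal_basis_of :: "'a::euclidean_space set \<Rightarrow> 'a set \<Rightarrow> bool" where
  "orthonormal_basis_of E B \<longleftrightarrow>
     B \<subseteq> E \<and> pairwise orthogonal B \<and> (\<forall>b\<in>B. norm b = 1) \<and> span B = E"

text \<open>
  Lebesgue measure of dimension \<open>dim E\<close> carried by a linear subspace \<open>E\<close>, built from an
  orthonormal basis of \<open>E\<close> in the way the library builds \<^const>\<open>lborel\<close> from \<open>Basis\<close>. By rotation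
  invariance of Lebesgue measure it does not depend on the basis that is chosen.
\<close>

definition lborel_of :: "'a::euclidean_space set \<Rightarrow> 'a measure" where
  "lborel_of E =
     (let B = (SOME B. orthonormal_basis_of E B)
      in distr (\<Pi>\<^sub>M b\<in>B. (lborel :: real measure)) borel (\<lambda>c. \<Sum>b\<in>B. c b *\<^sub>R b))"

text \<open>
  \<open>M\<close> is the volume and \<open>U\<close> the unit ball of the Euclidean space in which the surface area of \<open>A\<close>
  is taken. The limit exists for every convex body \<open>A\<close> of that space.
\<close>

definition surface_area_wrt :: "'a::euclidean_space measure \<Rightarrow> 'a set \<Rightarrow> 'a set \<Rightarrow> real" where
  "surface_area_wrt M U A =
     Lim (at_right 0)
       (\<lambda>t::real. (measure M {a + t *\<^sub>R u | a u. a \<in> A \<and> u \<in> U} - measure M A) / t)"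

definition surface_area :: "'a::euclidean_space set \<Rightarrow> real" where
  "surface_area A = surface_area_wrt lborel (cball 0 1) A"

definition surface_area_in :: "'a::euclidean_space set \<Rightarrow> 'a set \<Rightarrow> real" where
  "surface_area_in E A = surface_area_wrt (lborel_of E) (cball 0 1 \<inter> E) A"

text \<open>
  A genuine maximum: \<open>GREATEST\<close> is the largest element of the set of values, not merely its
  supremum. It exists for every symmetric convex body by continuity in \<open>\<xi>\<close>.
\<close>

definition max_section_surface_area :: "'a::euclidean_space set \<Rightarrow> real" where
  "max_section_surface_area K =
     (GREATEST s. s \<in> (\<lambda>\<xi>. surface_area_in (perp \<xi>) (K \<inter> perp \<xi>)) ` sphere 0 1)"

end

theory Submission
  imports Defs
begin

text \<open>
  A flat body beats every bound. Let \<open>e\<close> be a unit vector and let \<open>K\<close> be the part of the unit ball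
  that lies in the slab \<open>\<bar>x \<bullet> e\<bar> \<le> \<epsilon>\<close>. As \<open>\<epsilon>\<close> tends to \<open>0\<close>, the volume of \<open>K\<close> tends to \<open>0\<close>, while its
  surface area stays bounded below by the area of one of its two flat faces. The sections cannot
  compensate for this: \<open>K \<inter> perp \<xi>\<close> lies in the unit ball of \<open>perp \<xi>\<close>, so its surface area is at
  most that of an \<open>(n - 1)\<close>-dimensional unit ball, and \<open>\<xi> = e\<close> gives equality. The maximum over \<open>\<xi>\<close>
  is therefore attained and does not depend on \<open>\<epsilon>\<close>.

  The central sections of \<open>K\<close> are again balls or truncated balls, of one dimension less
  (\<open>truncated_ball_section\<close>). So two facts about the body \<open>A = {x. norm x \<le> 1 \<and> \<bar>x \<bullet> w\<bar> \<le> c}\<close> in a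
  subspace are enough, and they are proved for every measure that has the translation and scaling
  behaviour of Lebesgue measure on that subspace.

  The first fact is that the limit that defines the surface area of \<open>A\<close> exists
  (\<open>surface_area_truncated_ball\<close>). The shell between \<open>A\<close> and its parallel body at distance \<open>t\<close>
  consists of a radial shell over the spherical part of the boundary, whose volume is known by
  scaling, of two cylinders of height \<open>t\<close> over the flat faces, and of a rest along the two edges.
  Enlarging the radius of the cylinders from \<open>sqrt (1 - c\<^sup>2)\<close> to \<open>sqrt ((1 + t)\<^sup>2 - c\<^sup>2)\<close> absorbs that
  rest. The two radii agree in the limit, so the difference quotient is squeezed to
  an explicit value.

  The second fact is that truncation does not increase the surface area
  (\<open>surface_area_truncated_ball_le_ball\<close>). Translating the two caps that were cut off by \<open>t\<close> along
  their axis moves them into the parallel body of the ball and out of that of \<open>A\<close>. Hence the ball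
  exceeds \<open>A\<close> in volume by at most as much as the parallel body of the ball exceeds that of \<open>A\<close>.
\<close>

section \<open>Lebesgue measure on a subspace\<close>

text \<open>
  The properties of \<open>m\<close>-dimensional volume on \<open>E\<close> on which the geometry below depends. Both \<open>lborel\<close>
  on the whole space and \<open>lborel_of E\<close> have them, so that a body and its sections are treated alike,
  and no choice of coordinates on \<open>E\<close> is visible.
\<close>

locale subspace_volume =
  fixes M :: "'a::euclidean_space measure" and E :: "'a set" and m :: nat
  assumes sets_eq [measurable_cong, simp]: "sets M = sets borel"
    and subspace: "subspace E"
    and emeasure_affine: "\<lbrakk>v \<in> E; r > 0; S \<in> sets borel\<rbrakk> \<Longrightarrow>
      emeasure M ((\<lambda>x. v + r *\<^sub>R x) ` S) = ennreal (r ^ m) * emeasure M S"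
    and emeasure_cball_finite: "emeasure M (cball 0 1) < \<infinity>"

lemma affine_image_borel:
  fixes S :: "'a::euclidean_space set"
  assumes "r > 0" "S \<in> sets borel"
  shows "(\<lambda>x. v + r *\<^sub>R x) ` S \<in> sets borel"
proof -
  have "(\<lambda>x. v + r *\<^sub>R x) ` S = (\<lambda>y. (1 / r) *\<^sub>R (y - v)) -` S \<inter> space borel"
    using assms(1) by (force simp: image_iff)
  also have "\<dots> \<in> sets borel"
    using assms(2) by (intro measurable_sets[where A = borel]) auto
  finally show ?thesis .
qed

lemma lborel_affine_image:
  fixes S :: "'a::euclidean_space set"
  assumes "r > 0" "S \<in> sets borel"
  shows "emeasure lborel ((\<lambda>x. v + r *\<^sub>R x) ` S) = ennreal (r ^ DIM('a)) * emeasure lborel S"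
proof -
  have img: "(\<lambda>x. v + r *\<^sub>R x) ` S = (\<lambda>x. r *\<^sub>R x + v) ` S"
    by (simp add: add.commute)
  have meas: "(\<lambda>x. v + r *\<^sub>R x) ` S \<in> sets borel"
    using assms by (rule affine_image_borel)
  have "emeasure lborel ((\<lambda>x. v + r *\<^sub>R x) ` S) = emeasure lebesgue ((\<lambda>x. r *\<^sub>R x + v) ` S)"
    using meas unfolding img by simp
  also have "\<dots> = ennreal (r ^ DIM('a)) * emeasure lebesgue S"
    using assms(1) by (simp add: emeasure_lebesgue_affine)
  also have "emeasure lebesgue S = emeasure lborel S"
    using assms(2) by simp
  finally show ?thesis .
qed

lemma subspace_volume_lborel: "subspace_volume (lborel :: 'a::euclidean_space measure) UNIV DIM('a)"
proof
  show "emeasure lborel (cball (0::'a) 1) < \<infinity>"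
    using emeasure_bounded_finite bounded_cball by blast
qed (auto simp: lborel_affine_image)

text \<open>
  A product of one-dimensional Lebesgue measures is determined by its values on boxes, and there the
  scaling rule holds factor by factor.
\<close>

lemma PiM_lborel_affine:
  fixes B :: "'b set" and X :: "('b \<Rightarrow> real) set" and a :: "'b \<Rightarrow> real"
  assumes "finite B" "r > 0" "X \<in> sets (\<Pi>\<^sub>M b\<in>B. lborel)"
  shows "ennreal (r ^ card B) *
           emeasure (\<Pi>\<^sub>M b\<in>B. lborel)
             ((\<lambda>c. \<lambda>b\<in>B. a b + r * c b) -` X \<inter> space (\<Pi>\<^sub>M b\<in>B. lborel))
         = emeasure (\<Pi>\<^sub>M b\<in>B. lborel) X"
proof -
  interpret product_sigma_finite "\<lambda>_::'b. lborel :: real measure" ..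
  let ?P = "\<Pi>\<^sub>M b\<in>B. (lborel :: real measure)"
  let ?T = "\<lambda>c. \<lambda>b\<in>B. a b + r * c b"
  have T [measurable]: "?T \<in> measurable ?P ?P"
    by measurable
  have "scale_measure (ennreal (r ^ card B)) (distr ?P ?P ?T) = ?P"
  proof (rule PiM_eqI)
    fix A :: "'b \<Rightarrow> real set" assume A: "\<And>b. b \<in> B \<Longrightarrow> A b \<in> sets lborel"
    have pre: "?T -` (Pi\<^sub>E B A) \<inter> space ?P = Pi\<^sub>E B (\<lambda>b. (\<lambda>x. a b + r * x) -` A b)"
      by (auto simp: space_PiM PiE_iff extensional_def)
    have one: "ennreal r * emeasure lborel ((\<lambda>x. a b + r * x) -` A b) = emeasure lborel (A b)"
      and meas: "(\<lambda>x. a b + r * x) -` A b \<in> sets lborel" if "b \<in> B" for b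
    proof -
      have Ab: "A b \<in> sets borel" using A[OF that] by simp
      then show mm: "(\<lambda>x. a b + r * x) -` A b \<in> sets lborel"
        using measurable_sets[of "\<lambda>x. a b + r * x" borel borel "A b"] by simp
      have img: "(\<lambda>x. a b + r *\<^sub>R x) ` ((\<lambda>x. a b + r * x) -` A b) = A b"
      proof (intro equalityI subsetI)
        fix y assume "y \<in> A b"
        then have "(y - a b) / r \<in> (\<lambda>x. a b + r * x) -` A b" using assms(2) by simp
        then show "y \<in> (\<lambda>x. a b + r *\<^sub>R x) ` ((\<lambda>x. a b + r * x) -` A b)"
          using assms(2) by (intro image_eqI[where x = "(y - a b) / r"]) auto
      qed auto
      show "ennreal r * emeasure lborel ((\<lambda>x. a b + r * x) -` A b) = emeasure lborel (A b)"
        using lborel_affine_image[of r "(\<lambda>x. a b + r * x) -` A b" "a b"] mm assms(2)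
        unfolding img by simp
    qed
    have "emeasure (scale_measure (ennreal (r ^ card B)) (distr ?P ?P ?T)) (Pi\<^sub>E B A)
        = ennreal (r ^ card B) * emeasure ?P (Pi\<^sub>E B (\<lambda>b. (\<lambda>x. a b + r * x) -` A b))"
      using A assms(1) by (simp add: emeasure_distr pre sets_PiM_I_finite)
    also have "\<dots> = (\<Prod>b\<in>B. ennreal r) * (\<Prod>b\<in>B. emeasure lborel ((\<lambda>x. a b + r * x) -` A b))"
      using assms meas by (subst emeasure_PiM) (auto simp: ennreal_power)
    also have "\<dots> = (\<Prod>b\<in>B. emeasure lborel (A b))"
      unfolding prod.distrib[symmetric] by (rule prod.cong) (auto simp: one)
    finally show "emeasure (scale_measure (ennreal (r ^ card B)) (distr ?P ?P ?T)) (Pi\<^sub>E B A)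
        = (\<Prod>b\<in>B. emeasure lborel (A b))" .
  qed (use assms(1) in auto)
  then have "emeasure (scale_measure (ennreal (r ^ card B)) (distr ?P ?P ?T)) X = emeasure ?P X"
    by simp
  then show ?thesis
    using assms(3) by (simp add: emeasure_distr)
qed

lemma orthonormal_basis_of_some:
  fixes E :: "'a::euclidean_space set"
  assumes "subspace E"
  shows "orthonormal_basis_of E (SOME B. orthonormal_basis_of E B)"
proof -
  obtain B where "B \<subseteq> E" "pairwise orthogonal B" "\<And>x. x \<in> B \<Longrightarrow> norm x = 1" "span B = E"
    using orthonormal_basis_subspace[OF assms] by metis
  then have "orthonormal_basis_of E B" by (simp add: orthonormal_basis_of_def)
  then show ?thesis by (rule someI)
qed

lemma orthonormal_basis_of_card:
  fixes E :: "'a::euclidean_space set"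
  assumes "orthonormal_basis_of E B"
  shows "finite B" "card B = dim E"
proof -
  have "independent B"
    using assms unfolding orthonormal_basis_of_def
    by (intro pairwise_orthogonal_independent) auto
  then show "finite B" "card B = dim E"
    using assms dim_span_eq_card_independent[of B]
    by (auto simp: orthonormal_basis_of_def independent_imp_finite)
qed

lemma norm_orthonormal_sum:
  fixes B :: "'a::euclidean_space set"
  assumes "orthonormal_basis_of E B"
  shows "norm (\<Sum>b\<in>B. c b *\<^sub>R b) = sqrt (\<Sum>b\<in>B. (c b)\<^sup>2)"
proof -
  have fin: "finite B" using assms by (rule orthonormal_basis_of_card)
  have "(norm (\<Sum>b\<in>B. c b *\<^sub>R b))\<^sup>2 = (\<Sum>b\<in>B. (norm (c b *\<^sub>R b))\<^sup>2)"
    using assms fin by (intro norm_sum_Pythagorean)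
      (auto simp: orthonormal_basis_of_def pairwise_def orthogonal_def)
  also have "\<dots> = (\<Sum>b\<in>B. (c b)\<^sup>2)"
    using assms by (intro sum.cong) (auto simp: orthonormal_basis_of_def)
  finally show ?thesis by (metis norm_ge_zero real_sqrt_unique)
qed

text \<open>
  In the coordinates of an orthonormal basis, \<open>x \<mapsto> v + r x\<close> acts on each coordinate separately and the
  norm is the Euclidean norm of the coordinate vector. The volume of the unit ball thus depends on
  the dimension of \<open>E\<close> only, whichever basis \<open>lborel_of\<close> picks.
\<close>

lemma lborel_of_facts:
  fixes E :: "'a::euclidean_space set"
  assumes "subspace E"
  shows subspace_volume_lborel_of: "subspace_volume (lborel_of E) E (dim E)"
    and measure_lborel_of_unit_ball:
      "measure (lborel_of E) (cball 0 1 \<inter> E) = unit_ball_vol (real (dim E))"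
proof -
  define B where "B = (SOME B. orthonormal_basis_of E B)"
  define \<Phi> :: "('a \<Rightarrow> real) \<Rightarrow> 'a" where "\<Phi> = (\<lambda>c. \<Sum>b\<in>B. c b *\<^sub>R b)"
  let ?P = "\<Pi>\<^sub>M b\<in>B. (lborel :: real measure)"
  have B: "orthonormal_basis_of E B"
    unfolding B_def using assms by (rule orthonormal_basis_of_some)
  note fin = orthonormal_basis_of_card(1)[OF B]
  note card = orthonormal_basis_of_card(2)[OF B]
  have def: "lborel_of E = distr ?P borel \<Phi>"
    by (simp add: lborel_of_def B_def \<Phi>_def Let_def)
  have [measurable]: "\<Phi> \<in> borel_measurable ?P"
    unfolding \<Phi>_def by measurable
  have ball: "emeasure (lborel_of E) (cball 0 1) = ennreal (unit_ball_vol (real (dim E)))"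
  proof -
    have "\<Phi> -` cball 0 1 \<inter> space ?P = {f. sqrt (\<Sum>i\<in>B. (f i)\<^sup>2) \<le> 1} \<inter> space ?P"
      by (auto simp: \<Phi>_def norm_orthonormal_sum[OF B])
    then show ?thesis
      using emeasure_cball_aux[OF fin, of 1] by (simp add: def emeasure_distr card)
  qed
  have "\<Phi> c \<in> E" for c
  proof -
    have "\<Phi> c \<in> span B" unfolding \<Phi>_def by (intro span_sum span_scale span_base)
    then show ?thesis using B by (simp add: orthonormal_basis_of_def)
  qed
  then have "\<Phi> -` (cball 0 1 \<inter> E) = \<Phi> -` cball 0 1" by auto
  then have "emeasure (lborel_of E) (cball 0 1 \<inter> E) = emeasure (lborel_of E) (cball 0 1)"
    using closed_subspace[OF assms] by (simp add: def emeasure_distr)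
  then show "measure (lborel_of E) (cball 0 1 \<inter> E) = unit_ball_vol (real (dim E))"
    by (simp add: measure_def ball)
  show "subspace_volume (lborel_of E) E (dim E)"
  proof
    show "sets (lborel_of E) = sets borel" by (simp add: def)
    show "subspace E" by fact
    show "emeasure (lborel_of E) (cball 0 1) < \<infinity>" by (simp add: ball)
    fix v :: 'a and r :: real and S :: "'a set"
    assume v: "v \<in> E" and r: "r > 0" and S [measurable]: "S \<in> sets borel"
    define T where "T = (\<lambda>x. v + r *\<^sub>R x) ` S"
    have T [measurable]: "T \<in> sets borel"
      unfolding T_def using r S by (rule affine_image_borel)
    have "v \<in> span B" using B v by (simp add: orthonormal_basis_of_def)
    then obtain a where a: "v = \<Phi> a"
      unfolding \<Phi>_def span_finite[OF fin] by blast
    let ?T = "\<lambda>c. \<lambda>b\<in>B. a b + r * c b"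
    have \<Phi>T: "\<Phi> (?T c) = v + r *\<^sub>R \<Phi> c" for c
      by (simp add: a \<Phi>_def sum.distrib scaleR_add_left scaleR_sum_right)
    have mem: "v + r *\<^sub>R x \<in> T \<longleftrightarrow> x \<in> S" for x
      using r by (auto simp: T_def)
    have pre: "?T -` (\<Phi> -` T \<inter> space ?P) \<inter> space ?P = \<Phi> -` S \<inter> space ?P"
      by (auto simp: \<Phi>T mem space_PiM)
    have "ennreal (r ^ card B) * emeasure ?P (\<Phi> -` S \<inter> space ?P) = emeasure ?P (\<Phi> -` T \<inter> space ?P)"
      using PiM_lborel_affine[OF fin r, of "\<Phi> -` T \<inter> space ?P" a] unfolding pre by simp
    then show "emeasure (lborel_of E) ((\<lambda>x. v + r *\<^sub>R x) ` S)
        = ennreal (r ^ dim E) * emeasure (lborel_of E) S"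
      unfolding T_def[symmetric] by (simp add: def emeasure_distr card)
  qed
qed


section \<open>Cylinders, cones and truncated balls\<close>

text \<open>
  Half-open along the axis, so that stacked cylinders are disjoint.
\<close>

definition cylinder :: "'a::euclidean_space set \<Rightarrow> 'a \<Rightarrow> real \<Rightarrow> real \<Rightarrow> real \<Rightarrow> 'a set" where
  "cylinder E w r a b = {x \<in> E. a < x \<bullet> w \<and> x \<bullet> w \<le> b \<and> norm (x - (x \<bullet> w) *\<^sub>R w) \<le> r}"

definition truncated_ball :: "'a::euclidean_space set \<Rightarrow> 'a \<Rightarrow> real \<Rightarrow> 'a set" where
  "truncated_ball E w c = {x \<in> E. norm x \<le> 1 \<and> \<bar>x \<bullet> w\<bar> \<le> c}"

text \<open>
  The union of the segments from the origin to those points of the sphere of radius \<open>R\<close> whose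
  direction is far enough from \<open>w\<close> and \<open>- w\<close>. For \<open>R = 1\<close> these are the points of the sphere that
  the truncation \<open>\<bar>x \<bullet> w\<bar> \<le> c\<close> keeps.
\<close>

definition spherical_cone :: "'a::euclidean_space set \<Rightarrow> 'a \<Rightarrow> real \<Rightarrow> real \<Rightarrow> 'a set" where
  "spherical_cone E w c R = {x \<in> E. norm x \<le> R \<and> \<bar>x \<bullet> w\<bar> \<le> c * norm x}"

definition parallel_body :: "'a::euclidean_space set \<Rightarrow> 'a set \<Rightarrow> real \<Rightarrow> 'a set" where
  "parallel_body U A t = {a + t *\<^sub>R u | a u. a \<in> A \<and> u \<in> U}"

lemma norm_split_unit:
  fixes w x :: "'a::euclidean_space"
  assumes "norm w = 1"
  shows "(norm x)\<^sup>2 = (x \<bullet> w)\<^sup>2 + (norm (x - (x \<bullet> w) *\<^sub>R w))\<^sup>2"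
proof -
  have "w \<bullet> w = 1" using assms by (simp add: norm_eq_sqrt_inner)
  then show ?thesis
    unfolding power2_norm_eq_inner
    by (simp add: inner_diff_left inner_diff_right inner_commute power2_eq_square)
qed

lemma norm_orthogonal_part_le:
  fixes w x :: "'a::euclidean_space"
  assumes "norm w = 1"
  shows "norm (x - (x \<bullet> w) *\<^sub>R w) \<le> norm x"
proof (rule power2_le_imp_le)
  show "(norm (x - (x \<bullet> w) *\<^sub>R w))\<^sup>2 \<le> (norm x)\<^sup>2"
    using norm_split_unit[OF assms, of x] zero_le_power2[of "x \<bullet> w"] by linarith
qed simp

text \<open>
  An additive nonnegative function is monotone, and a monotone solution of Cauchy's functional
  equation is linear. This replaces Fubini's theorem in the
  computation of the volume of a cylinder as height times base.
\<close>

lemma additive_nonneg_linear: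
  fixes f :: "real \<Rightarrow> real"
  assumes add: "\<And>s t. 0 \<le> s \<Longrightarrow> 0 \<le> t \<Longrightarrow> f (s + t) = f s + f t"
    and nonneg: "\<And>t. 0 \<le> t \<Longrightarrow> 0 \<le> f t"
    and t: "0 \<le> t"
  shows "f t = t * f 1"
proof -
  have mono: "f s \<le> f u" if "0 \<le> s" "s \<le> u" for s u
    using add[of s "u - s"] nonneg[of "u - s"] that by simp
  have zero: "f 0 = 0" using add[of 0 0] by simp
  have mult: "f (real n * s) = real n * f s" if "0 \<le> s" for n s
  proof (induction n)
    case (Suc n)
    have "f (real (Suc n) * s) = f (real n * s + s)" by (simp add: algebra_simps)
    with Suc that show ?case by (simp add: add algebra_simps)
  qed (simp add: zero)
  have "\<bar>f t - t * f 1\<bar> \<le> f 1 / real (Suc n)" for n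
  proof -
    \<comment> \<open>Compare \<open>t\<close> with the multiples of \<open>1 / (n + 1)\<close> on either side of it.\<close>
    define k where "k = nat \<lfloor>t * real (Suc n)\<rfloor>"
    have k: "real k \<le> t * real (Suc n)" "t * real (Suc n) \<le> real (Suc k)"
      using t by (auto simp: k_def) linarith+
    have "real (Suc n) * f t = f (t * real (Suc n))"
      using mult[OF t, of "Suc n"] by (simp add: mult.commute)
    moreover have "f (real k) \<le> f (t * real (Suc n))" "f (t * real (Suc n)) \<le> f (real (Suc k))"
      using k t by (auto intro!: mono)
    ultimately have "real k * f 1 \<le> real (Suc n) * f t" "real (Suc n) * f t \<le> real (Suc k) * f 1"
      using mult[of 1 k] mult[of 1 "Suc k"] by simp_all
    moreover have "real k * f 1 \<le> t * real (Suc n) * f 1" "t * real (Suc n) * f 1 \<le> real (Suc k) * f 1"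
      using k nonneg[of 1] by (auto intro!: mult_right_mono)
    ultimately have "\<bar>real (Suc n) * f t - t * real (Suc n) * f 1\<bar> \<le> f 1"
      by (simp add: algebra_simps abs_le_iff)
    moreover have "real (Suc n) * f t - t * real (Suc n) * f 1 = real (Suc n) * (f t - t * f 1)"
      by (simp add: algebra_simps)
    ultimately have "real (Suc n) * \<bar>f t - t * f 1\<bar> \<le> f 1"
      by (simp only: abs_mult abs_of_nat)
    then show ?thesis
      by (simp add: pos_le_divide_eq mult.commute)
  qed
  moreover have "(\<lambda>n. f 1 / real (Suc n)) \<longlonglongrightarrow> 0"
    using LIMSEQ_Suc[OF lim_const_over_n[of "f 1"]] by simp
  ultimately have "\<bar>f t - t * f 1\<bar> \<le> 0"
    by (metis LIMSEQ_le_const)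
  then show ?thesis by simp
qed

context subspace_volume
begin

abbreviation U where "U \<equiv> cball 0 1 \<inter> E"

lemma E_borel [measurable]: "E \<in> sets borel"
  using closed_subspace[OF subspace] by simp

lemma bounded_fmeasurable:
  assumes S: "S \<in> sets borel" and "bounded S"
  shows "S \<in> fmeasurable M"
proof -
  obtain R where R: "R > 0" "\<And>x. x \<in> S \<Longrightarrow> norm x \<le> R"
    using \<open>bounded S\<close> bounded_normE by blast
  have ball: "(\<lambda>x::'a. 0 + R *\<^sub>R x) ` cball 0 1 = cball 0 R"
    using R(1) cball_scale[of R "0::'a" 1] by simp
  have "emeasure M ((\<lambda>x. 0 + R *\<^sub>R x) ` cball 0 1) = ennreal (R ^ m) * emeasure M (cball 0 1)"
    using R(1) subspace by (intro emeasure_affine) (auto simp: subspace_0)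
  then have fin: "emeasure M (cball 0 R) < \<infinity>"
    using emeasure_cball_finite unfolding ball by (simp add: ennreal_mult_less_top)
  have "emeasure M S \<le> emeasure M (cball 0 R)"
    using R by (intro emeasure_mono) auto
  then show ?thesis
    using S fin by (intro fmeasurableI) auto
qed

lemma measure_affine:
  assumes "v \<in> E" "r > 0" "S \<in> sets borel"
  shows "measure M ((\<lambda>x. v + r *\<^sub>R x) ` S) = r ^ m * measure M S"
  using emeasure_affine[OF assms] assms(2) by (simp add: measure_def enn2real_mult)

lemma measure_translation:
  assumes "v \<in> E" "S \<in> sets borel"
  shows "measure M ((+) v ` S) = measure M S"
  using measure_affine[of v 1 S] assms by simp

lemma measure_scale:
  assumes "r > 0" "S \<in> sets borel"
  shows "measure M ((*\<^sub>R) r ` S) = r ^ m * measure M S"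
  using measure_affine[of 0 r S] assms subspace_0[OF subspace] by simp

lemma cylinder_borel [measurable]: "cylinder E w r a b \<in> sets borel"
  unfolding cylinder_def by measurable

lemma cylinder_fmeasurable:
  assumes "norm w = 1"
  shows "cylinder E w r a b \<in> fmeasurable M"
proof (intro bounded_fmeasurable cylinder_borel)
  have "norm x \<le> (\<bar>a\<bar> + \<bar>b\<bar>) + r" if "x \<in> cylinder E w r a b" for x
  proof -
    have "norm x \<le> norm (x - (x \<bullet> w) *\<^sub>R w) + norm ((x \<bullet> w) *\<^sub>R w)"
      using norm_triangle_ineq[of "x - (x \<bullet> w) *\<^sub>R w" "(x \<bullet> w) *\<^sub>R w"] by simp
    with that assms show ?thesis
      by (auto simp: cylinder_def)
  qed
  then show "bounded (cylinder E w r a b)" by (auto simp: bounded_iff)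
qed

lemma cylinder_translate:
  assumes "norm w = 1" "w \<in> E"
  shows "(+) (h *\<^sub>R w) ` cylinder E w r a b = cylinder E w r (a + h) (b + h)"
proof -
  have ww: "w \<bullet> w = 1" using assms(1) by (simp add: norm_eq_sqrt_inner)
  have hw: "h *\<^sub>R w \<in> E" for h using assms(2) subspace by (simp add: subspace_scale)
  show ?thesis
  proof (intro equalityI subsetI)
    fix x assume x: "x \<in> cylinder E w r (a + h) (b + h)"
    have "x - h *\<^sub>R w \<in> cylinder E w r a b"
      using x hw subspace by (auto simp: cylinder_def inner_diff_left ww subspace_diff algebra_simps)
    then show "x \<in> (+) (h *\<^sub>R w) ` cylinder E w r a b"
      by (intro image_eqI[where x = "x - h *\<^sub>R w"]) auto
  next
    fix x assume "x \<in> (+) (h *\<^sub>R w) ` cylinder E w r a b"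
    then show "x \<in> cylinder E w r (a + h) (b + h)"
      using hw subspace by (auto simp: cylinder_def inner_add_left ww subspace_add algebra_simps)
  qed
qed

text \<open>
  The \<open>(m - 1)\<close>-dimensional volume of a disc of radius \<open>r\<close> orthogonal to \<open>w\<close>, read off from the
  cylinder of height one over it so that no measure on a smaller subspace is needed.
\<close>

definition disc_area :: "'a \<Rightarrow> real \<Rightarrow> real" where
  "disc_area w r = measure M (cylinder E w r 0 1)"

text \<open>
  Stacking cylinders makes the volume additive in the height, hence proportional to it.
\<close>

lemma measure_cylinder:
  assumes w: "norm w = 1" "w \<in> E" and "a \<le> b"
  shows "measure M (cylinder E w r a b) = (b - a) * disc_area w r"
proof -
  have shift: "measure M (cylinder E w r (x + h) (y + h)) = measure M (cylinder E w r x y)" for x y h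
    using measure_translation[of "h *\<^sub>R w" "cylinder E w r x y"] w subspace
    by (simp add: cylinder_translate subspace_scale)
  have "measure M (cylinder E w r 0 (b - a)) = (b - a) * measure M (cylinder E w r 0 1)"
  proof (rule additive_nonneg_linear[where f = "\<lambda>t. measure M (cylinder E w r 0 t)"])
    fix s t :: real assume "0 \<le> s" "0 \<le> t"
    then have "cylinder E w r 0 (s + t) = cylinder E w r 0 s \<union> cylinder E w r s (s + t)"
      by (auto simp: cylinder_def)
    moreover have "cylinder E w r 0 s \<inter> cylinder E w r s (s + t) = {}"
      by (auto simp: cylinder_def)
    ultimately have "measure M (cylinder E w r 0 (s + t))
        = measure M (cylinder E w r 0 s) + measure M (cylinder E w r s (s + t))"
      using measure_Un3[OF cylinder_fmeasurable cylinder_fmeasurable, OF w(1) w(1)] by simp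
    then show "measure M (cylinder E w r 0 (s + t))
        = measure M (cylinder E w r 0 s) + measure M (cylinder E w r 0 t)"
      using shift[of 0 s t] by (simp add: add.commute)
  qed (use \<open>a \<le> b\<close> in auto)
  with shift[of 0 a "b - a"] show ?thesis by (simp add: disc_area_def)
qed

lemma disc_area_nonneg: "0 \<le> disc_area w r"
  by (simp add: disc_area_def)

lemma disc_area_mono:
  assumes "norm w = 1" "r \<le> s"
  shows "disc_area w r \<le> disc_area w s"
  unfolding disc_area_def using assms
  by (intro measure_mono_fmeasurable cylinder_fmeasurable) (auto simp: cylinder_def)

text \<open>
  Scaling all of space by \<open>r\<close> multiplies the volume of a cylinder by \<open>r ^ m\<close>, and one factor \<open>r\<close> of it
  comes from the height. The quotient form \<open>r ^ m / r\<close> avoids a subtraction in the exponent. The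
  lemma serves to show that the area of a disc is continuous in its radius.
\<close>

lemma disc_area_scale:
  assumes w: "norm w = 1" "w \<in> E" and r: "r > 0"
  shows "disc_area w r = r ^ m / r * disc_area w 1"
proof -
  have "(*\<^sub>R) r ` cylinder E w 1 0 1 = cylinder E w r 0 r"
  proof (intro equalityI subsetI)
    fix x assume x: "x \<in> cylinder E w r 0 r"
    have "(1 / r) *\<^sub>R x - ((1 / r) *\<^sub>R x \<bullet> w) *\<^sub>R w = (1 / r) *\<^sub>R (x - (x \<bullet> w) *\<^sub>R w)"
      by (simp add: algebra_simps)
    then have "norm ((1 / r) *\<^sub>R x - ((1 / r) *\<^sub>R x \<bullet> w) *\<^sub>R w) = norm (x - (x \<bullet> w) *\<^sub>R w) / r"
      using r by simp
    then have "(1 / r) *\<^sub>R x \<in> cylinder E w 1 0 1"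
      using x r subspace unfolding cylinder_def by (simp add: subspace_scale)
    then show "x \<in> (*\<^sub>R) r ` cylinder E w 1 0 1"
      using r by (intro image_eqI[where x = "(1 / r) *\<^sub>R x"]) auto
  next
    fix x assume "x \<in> (*\<^sub>R) r ` cylinder E w 1 0 1"
    then obtain y where y: "y \<in> cylinder E w 1 0 1" "x = r *\<^sub>R y" by auto
    have "x - (x \<bullet> w) *\<^sub>R w = r *\<^sub>R (y - (y \<bullet> w) *\<^sub>R w)"
      by (simp add: y algebra_simps)
    then have "norm (x - (x \<bullet> w) *\<^sub>R w) = r * norm (y - (y \<bullet> w) *\<^sub>R w)"
      using r by simp
    then show "x \<in> cylinder E w r 0 r"
      using y r subspace unfolding cylinder_def by (simp add: subspace_scale)
  qed
  then have "measure M (cylinder E w r 0 r) = r ^ m * disc_area w 1"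
    using measure_scale[OF r, of "cylinder E w 1 0 1"] by (simp add: disc_area_def)
  then show ?thesis
    using measure_cylinder[OF w, of 0 r r] r by (simp add: field_simps)
qed

lemma truncated_ball_borel [measurable]: "truncated_ball E w c \<in> sets borel"
  unfolding truncated_ball_def by measurable

lemma spherical_cone_borel [measurable]: "spherical_cone E w c R \<in> sets borel"
  unfolding spherical_cone_def by measurable

lemma truncated_ball_fmeasurable: "truncated_ball E w c \<in> fmeasurable M"
  by (intro bounded_fmeasurable truncated_ball_borel) (auto simp: truncated_ball_def bounded_iff)

lemma spherical_cone_fmeasurable: "spherical_cone E w c R \<in> fmeasurable M"
  by (intro bounded_fmeasurable spherical_cone_borel) (auto simp: spherical_cone_def bounded_iff)

lemma measure_spherical_cone:
  assumes "R > 0"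
  shows "measure M (spherical_cone E w c R) = R ^ m * measure M (spherical_cone E w c 1)"
proof -
  have "(*\<^sub>R) R ` spherical_cone E w c 1 = spherical_cone E w c R"
  proof (intro equalityI subsetI)
    fix x assume x: "x \<in> spherical_cone E w c R"
    then have "(1 / R) *\<^sub>R x \<in> spherical_cone E w c 1"
      using assms subspace by (auto simp: spherical_cone_def subspace_scale abs_mult field_simps)
    then show "x \<in> (*\<^sub>R) R ` spherical_cone E w c 1"
      using assms by (intro image_eqI[where x = "(1 / R) *\<^sub>R x"]) auto
  next
    fix x assume "x \<in> (*\<^sub>R) R ` spherical_cone E w c 1"
    then show "x \<in> spherical_cone E w c R"
      using assms subspace
      by (auto simp: spherical_cone_def subspace_scale abs_mult field_simps)
  qed
  then show ?thesis
    using measure_scale[OF assms, of "spherical_cone E w c 1"] by simp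
qed

lemma compact_U: "compact U"
  using closed_subspace[OF subspace] by (simp add: compact_Int_closed)

lemma compact_parallel_body:
  assumes "compact A"
  shows "compact (parallel_body U A t)"
proof -
  have "parallel_body U A t = (\<lambda>p. fst p + t *\<^sub>R snd p) ` (A \<times> U)"
    by (force simp: parallel_body_def image_iff)
  then show ?thesis
    using assms compact_U
    by (auto intro!: compact_continuous_image compact_Times continuous_intros simp del: Int_iff)
qed

lemma compact_truncated_ball: "compact (truncated_ball E w c)"
proof -
  have "truncated_ball E w c = cball 0 1 \<inter> (E \<inter> {x. \<bar>x \<bullet> w\<bar> \<le> c})"
    by (auto simp: truncated_ball_def)
  also have "compact \<dots>"
    using closed_subspace[OF subspace]
    by (intro compact_Int_closed closed_Int closed_Collect_le continuous_intros) auto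
  finally show ?thesis .
qed

lemma parallel_body_fmeasurable:
  assumes "compact A"
  shows "parallel_body U A t \<in> fmeasurable M"
  using compact_parallel_body[OF assms]
  by (intro bounded_fmeasurable) (auto intro: borel_compact compact_imp_bounded)

section \<open>The surface area of a truncated ball\<close>

lemma measure_Un_disjoint:
  assumes "A \<in> fmeasurable M" "B \<in> fmeasurable M" "A \<inter> B = {}"
  shows "measure M (A \<union> B) = measure M A + measure M B"
  using measure_Un3[OF assms(1,2)] assms(3) by simp

text \<open>
  The points over the spherical part are reached radially from the sphere, and those over a flat
  face are reached from that face along the axis; \<open>sqrt (1 - c\<^sup>2)\<close> is the radius of the faces.
\<close>

lemma parallel_truncated_ball_superset:
  assumes w: "norm w = 1" "w \<in> E" and c: "0 < c" "c < 1" and t: "t > 0"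
  defines "\<rho> \<equiv> sqrt (1 - c\<^sup>2)"
  shows "truncated_ball E w c \<union> (spherical_cone E w c (1 + t) - spherical_cone E w c 1)
           \<union> cylinder E w \<rho> c (c + t) \<union> cylinder E (- w) \<rho> c (c + t)
         \<subseteq> parallel_body U (truncated_ball E w c) t"
proof -
  have c2: "c\<^sup>2 < 1" using c by (simp add: power_less_one_iff)
  have parallelI: "x \<in> parallel_body U (truncated_ball E w c) t"
    if "a \<in> truncated_ball E w c" "u \<in> E" "norm u \<le> t" "x = a + u" for x a u
  proof -
    have "(1 / t) *\<^sub>R u \<in> U" "x = a + t *\<^sub>R ((1 / t) *\<^sub>R u)"
      using that t subspace by (auto simp: subspace_scale field_simps)
    with that(1) show ?thesis unfolding parallel_body_def by blast
  qed
  have cone: "x \<in> parallel_body U (truncated_ball E w c) t"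
    if x: "x \<in> E" "1 < norm x" "norm x \<le> 1 + t" "\<bar>x \<bullet> w\<bar> \<le> c * norm x" for x
  proof (rule parallelI)
    show "(1 / norm x) *\<^sub>R x \<in> truncated_ball E w c"
      using x subspace by (auto simp: truncated_ball_def subspace_scale abs_mult field_simps)
    show "(1 - 1 / norm x) *\<^sub>R x \<in> E" using x subspace by (simp add: subspace_scale)
    have "0 \<le> 1 - 1 / norm x" using x(2) by (simp add: divide_le_eq)
    then have "\<bar>1 - 1 / norm x\<bar> * norm x = norm x - 1"
      using x(2) by (simp only: abs_of_nonneg left_diff_distrib) auto
    then show "norm ((1 - 1 / norm x) *\<^sub>R x) \<le> t" using x(3) by simp
    show "x = (1 / norm x) *\<^sub>R x + (1 - 1 / norm x) *\<^sub>R x" by (simp add: algebra_simps)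
  qed
  have cyl: "x \<in> parallel_body U (truncated_ball E w c) t"
    if v: "norm v = 1" "v \<in> E" "truncated_ball E v c = truncated_ball E w c"
      and x: "x \<in> cylinder E v \<rho> c (c + t)" for x v
  proof (rule parallelI)
    have vv: "v \<bullet> v = 1" using v(1) by (simp add: norm_eq_sqrt_inner)
    define y where "y = x - (x \<bullet> v - c) *\<^sub>R v"
    have yv: "y \<bullet> v = c" by (simp add: y_def inner_diff_left vv)
    have "y - (y \<bullet> v) *\<^sub>R v = x - (x \<bullet> v) *\<^sub>R v"
      unfolding yv by (simp add: y_def algebra_simps)
    then have "(norm y)\<^sup>2 = c\<^sup>2 + (norm (x - (x \<bullet> v) *\<^sub>R v))\<^sup>2"
      using norm_split_unit[OF v(1), of y] yv by simp
    also have "\<dots> \<le> c\<^sup>2 + \<rho>\<^sup>2"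
      using x by (auto simp: cylinder_def intro!: power_mono)
    also have "\<dots> = 1" using c2 by (simp add: \<rho>_def)
    finally have "norm y \<le> 1" by (simp add: power_le_one_iff abs_square_le_1)
    moreover have "y \<in> E"
      using x v subspace by (auto simp: y_def cylinder_def subspace_diff subspace_scale)
    ultimately have "y \<in> truncated_ball E v c" using yv c by (simp add: truncated_ball_def)
    then show "y \<in> truncated_ball E w c" by (simp add: v(3))
    show "(x \<bullet> v - c) *\<^sub>R v \<in> E" using v subspace by (simp add: subspace_scale)
    show "norm ((x \<bullet> v - c) *\<^sub>R v) \<le> t" using x v by (auto simp: cylinder_def)
    show "x = y + (x \<bullet> v - c) *\<^sub>R v" by (simp add: y_def)
  qed
  have "truncated_ball E w c \<subseteq> parallel_body U (truncated_ball E w c) t"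
    using t subspace_0[OF subspace] by (auto intro: parallelI[where u = 0])
  moreover have "cylinder E w \<rho> c (c + t) \<subseteq> parallel_body U (truncated_ball E w c) t"
    using cyl[of w] w by blast
  moreover have "cylinder E (- w) \<rho> c (c + t) \<subseteq> parallel_body U (truncated_ball E w c) t"
    using cyl[of "- w"] w subspace by (auto simp: subspace_neg truncated_ball_def)
  moreover have "spherical_cone E w c (1 + t) - spherical_cone E w c 1
      \<subseteq> parallel_body U (truncated_ball E w c) t"
    by (intro subsetI cone) (auto simp: spherical_cone_def)
  ultimately show ?thesis by blast
qed

text \<open>
  A point \<open>x\<close> of the parallel body has norm at most \<open>1 + t\<close>. If it lies beyond the height \<open>c\<close> of a
  face, its distance from the axis is therefore at most \<open>sqrt ((1 + t)\<^sup>2 - c\<^sup>2)\<close>; this bound includes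
  the rounded neighbourhood of the edge, which needs no description of its own.
\<close>

lemma parallel_truncated_ball_subset:
  assumes w: "norm w = 1" "w \<in> E" and c: "0 < c" "c < 1" and t: "t > 0"
  defines "\<sigma> \<equiv> sqrt ((1 + t)\<^sup>2 - c\<^sup>2)"
  shows "parallel_body U (truncated_ball E w c) t
         \<subseteq> truncated_ball E w c \<union> (spherical_cone E w c (1 + t) - spherical_cone E w c 1)
           \<union> cylinder E w \<sigma> c (c + t) \<union> cylinder E (- w) \<sigma> c (c + t)"
proof
  fix x assume "x \<in> parallel_body U (truncated_ball E w c) t"
  then obtain a u where au: "x = a + t *\<^sub>R u" "a \<in> truncated_ball E w c" "u \<in> E" "norm u \<le> 1"
    by (auto simp: parallel_body_def)
  have xE: "x \<in> E"
    using au subspace by (auto simp: truncated_ball_def subspace_add subspace_scale)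
  have tu: "norm (t *\<^sub>R u) \<le> t" using au(4) t by (simp add: mult_left_le)
  then have nx: "norm x \<le> 1 + t"
    using au(1,2) norm_triangle_ineq[of a "t *\<^sub>R u"] by (auto simp: truncated_ball_def)
  have "\<bar>(t *\<^sub>R u) \<bullet> w\<bar> \<le> t"
    using Cauchy_Schwarz_ineq2[of "t *\<^sub>R u" w] tu w(1) by simp
  moreover have "\<bar>x \<bullet> w\<bar> \<le> \<bar>a \<bullet> w\<bar> + \<bar>(t *\<^sub>R u) \<bullet> w\<bar>"
    unfolding au(1) inner_add_left by (rule abs_triangle_ineq)
  ultimately have hx: "\<bar>x \<bullet> w\<bar> \<le> c + t"
    using au(2) by (simp add: truncated_ball_def)
  show "x \<in> truncated_ball E w c \<union> (spherical_cone E w c (1 + t) - spherical_cone E w c 1)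
           \<union> cylinder E w \<sigma> c (c + t) \<union> cylinder E (- w) \<sigma> c (c + t)"
  proof (cases "\<bar>x \<bullet> w\<bar> \<le> c")
    case h: True
    show ?thesis
    proof (cases "norm x \<le> 1")
      case False
      then have "c \<le> c * norm x" using c by simp
      with False h show ?thesis using xE nx by (auto simp: spherical_cone_def)
    qed (use h xE in \<open>auto simp: truncated_ball_def\<close>)
  next
    case h: False
    have "(norm x)\<^sup>2 \<le> (1 + t)\<^sup>2" using nx by (intro power_mono) auto
    moreover have "c\<^sup>2 \<le> (x \<bullet> w)\<^sup>2" using h c by (simp add: abs_le_square_iff[symmetric])
    ultimately have "(norm (x - (x \<bullet> w) *\<^sub>R w))\<^sup>2 \<le> (1 + t)\<^sup>2 - c\<^sup>2"
      using norm_split_unit[OF w(1), of x] by linarith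
    then have "norm (x - (x \<bullet> w) *\<^sub>R w) \<le> \<sigma>"
      unfolding \<sigma>_def by (rule real_le_rsqrt)
    then show ?thesis
      using h hx xE by (auto simp: cylinder_def abs_if split: if_splits)
  qed
qed

text \<open>
  In the cone the distance from the axis is at least \<open>sqrt (1 - c\<^sup>2) / c\<close> times the height, so above
  height \<open>c\<close> it exceeds the radius of the face.
\<close>

lemma truncated_ball_pieces_disjoint:
  assumes w: "norm w = 1" and c: "0 < c" "c < 1"
  defines "\<rho> \<equiv> sqrt (1 - c\<^sup>2)"
  shows "spherical_cone E w c R \<inter> cylinder E w \<rho> c b = {}"
proof -
  have False if x: "\<bar>x \<bullet> w\<bar> \<le> c * norm x" "c < x \<bullet> w" "norm (x - (x \<bullet> w) *\<^sub>R w) \<le> \<rho>" for x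
  proof -
    have c2: "c\<^sup>2 < 1" using c by (simp add: power_less_one_iff)
    have "(x \<bullet> w)\<^sup>2 \<le> (c * norm x)\<^sup>2"
      using x(1) power_mono[OF x(1), of 2] by simp
    moreover have "(norm (x - (x \<bullet> w) *\<^sub>R w))\<^sup>2 \<le> \<rho>\<^sup>2"
      using x(3) by (rule power_mono) simp
    then have "(norm x)\<^sup>2 \<le> (x \<bullet> w)\<^sup>2 + (1 - c\<^sup>2)"
      using norm_split_unit[OF w, of x] c2 by (simp add: \<rho>_def)
    then have "c\<^sup>2 * (norm x)\<^sup>2 \<le> c\<^sup>2 * ((x \<bullet> w)\<^sup>2 + (1 - c\<^sup>2))"
      by (rule mult_left_mono) simp
    ultimately have "(1 - c\<^sup>2) * (x \<bullet> w)\<^sup>2 \<le> (1 - c\<^sup>2) * c\<^sup>2"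
      by (simp add: power_mult_distrib algebra_simps)
    then have "(x \<bullet> w)\<^sup>2 \<le> c\<^sup>2" using c2 by simp
    moreover have "c\<^sup>2 < (x \<bullet> w)\<^sup>2" using x(2) c by (intro power_strict_mono) auto
    ultimately show False by simp
  qed
  then show ?thesis by (auto simp: spherical_cone_def cylinder_def)
qed

lemma measure_cone_shell:
  assumes "t > 0"
  shows "measure M (spherical_cone E w c (1 + t) - spherical_cone E w c 1)
       = ((1 + t) ^ m - 1) * measure M (spherical_cone E w c 1)"
proof -
  have "measure M (spherical_cone E w c (1 + t) - spherical_cone E w c 1)
      = measure M (spherical_cone E w c (1 + t)) - measure M (spherical_cone E w c 1)"
    using assms spherical_cone_fmeasurable[of w c "1 + t"]
    by (intro measure_Diff) (auto simp: spherical_cone_def fmeasurable_def)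
  then show ?thesis
    using measure_spherical_cone[of "1 + t" w c] assms by (simp add: algebra_simps)
qed

lemma measure_parallel_truncated_ball_bounds:
  assumes w: "norm w = 1" "w \<in> E" and c: "0 < c" "c < 1" and t: "t > 0"
  defines "increment \<equiv> measure M (parallel_body U (truncated_ball E w c) t)
                        - measure M (truncated_ball E w c)"
    and "bound \<equiv> \<lambda>r. ((1 + t) ^ m - 1) * measure M (spherical_cone E w c 1)
                     + t * (disc_area w r + disc_area (- w) r)"
  shows "bound (sqrt (1 - c\<^sup>2)) \<le> increment" "increment \<le> bound (sqrt ((1 + t)\<^sup>2 - c\<^sup>2))"
proof -
  let ?A = "truncated_ball E w c" and ?P = "parallel_body U (truncated_ball E w c) t"
  let ?S = "spherical_cone E w c (1 + t) - spherical_cone E w c 1"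
  let ?C = "\<lambda>v r. cylinder E v r c (c + t)"
  have mw: "norm (- w) = 1" "- w \<in> E" using w subspace by (auto simp: subspace_neg)
  have cyl: "measure M (?C w r) = t * disc_area w r"
    "measure M (?C (- w) r) = t * disc_area (- w) r" for r
    using measure_cylinder[OF w, of c "c + t" r] measure_cylinder[OF mw, of c "c + t" r] t by simp_all
  have fm: "?A \<in> fmeasurable M" "?S \<in> fmeasurable M" "?C w r \<in> fmeasurable M"
    "?C (- w) r \<in> fmeasurable M" for r
    using w(1) mw(1)
    by (simp_all add: truncated_ball_fmeasurable cylinder_fmeasurable fmeasurable_Diff
        spherical_cone_fmeasurable del: norm_minus_cancel)
  have P: "?P \<in> fmeasurable M"
    by (intro parallel_body_fmeasurable compact_truncated_ball)
  let ?r = "sqrt (1 - c\<^sup>2)"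
  have disj: "?A \<inter> ?S = {}" "(?A \<union> ?S) \<inter> ?C w ?r = {}"
    "(?A \<union> ?S \<union> ?C w ?r) \<inter> ?C (- w) ?r = {}"
  proof -
    show "?A \<inter> ?S = {}" by (auto simp: truncated_ball_def spherical_cone_def)
    have A: "?A \<inter> ?C w ?r = {}" "?A \<inter> ?C (- w) ?r = {}"
      by (auto simp: truncated_ball_def cylinder_def)
    have "spherical_cone E (- w) c R = spherical_cone E w c R" for R
      by (simp add: spherical_cone_def)
    then have S: "?S \<inter> ?C w ?r = {}" "?S \<inter> ?C (- w) ?r = {}"
      using truncated_ball_pieces_disjoint[OF w(1) c, of "1 + t" "c + t"]
        truncated_ball_pieces_disjoint[OF mw(1) c, of "1 + t" "c + t"] by auto
    have "?C w ?r \<inter> ?C (- w) ?r = {}" using c by (auto simp: cylinder_def)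
    with A S show "(?A \<union> ?S) \<inter> ?C w ?r = {}" "(?A \<union> ?S \<union> ?C w ?r) \<inter> ?C (- w) ?r = {}" by blast+
  qed
  have "measure M (?A \<union> ?S \<union> ?C w ?r \<union> ?C (- w) ?r)
      = measure M ?A + measure M ?S + measure M (?C w ?r) + measure M (?C (- w) ?r)"
    using disj fm by (simp add: measure_Un_disjoint fmeasurable.Un)
  moreover have "measure M (?A \<union> ?S \<union> ?C w ?r \<union> ?C (- w) ?r) \<le> measure M ?P"
    by (intro measure_mono_fmeasurable parallel_truncated_ball_superset w c t P) simp_all
  ultimately show "bound ?r \<le> increment"
    unfolding bound_def increment_def measure_cone_shell[OF t] cyl by (simp add: algebra_simps)
  let ?s = "sqrt ((1 + t)\<^sup>2 - c\<^sup>2)"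
  have "measure M ?P \<le> measure M (?A \<union> ?S \<union> ?C w ?s \<union> ?C (- w) ?s)"
    using fm fmeasurableD[OF P]
    by (intro measure_mono_fmeasurable parallel_truncated_ball_subset w c t fmeasurable.Un)
  also have "\<dots> \<le> measure M (?A \<union> ?S \<union> ?C w ?s) + measure M (?C (- w) ?s)"
    by (rule measure_Un_le) simp_all
  also have "measure M (?A \<union> ?S \<union> ?C w ?s) \<le> measure M (?A \<union> ?S) + measure M (?C w ?s)"
    by (rule measure_Un_le) simp_all
  also have "measure M (?A \<union> ?S) \<le> measure M ?A + measure M ?S"
    by (rule measure_Un_le) simp_all
  finally show "increment \<le> bound ?s"
    unfolding bound_def increment_def measure_cone_shell[OF t] cyl by (simp add: algebra_simps)
qed

lemma power_difference_quotient_tendsto: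
  "((\<lambda>t::real. ((1 + t) ^ m - 1) / t) \<longlongrightarrow> real m) (at_right 0)"
proof -
  have "((\<lambda>x::real. x ^ m) has_real_derivative real m) (at 1)"
    by (auto intro!: derivative_eq_intros)
  then have "((\<lambda>h::real. ((1 + h) ^ m - 1) / h) \<longlongrightarrow> real m) (at 0)"
    by (simp add: DERIV_def)
  then show ?thesis
    by (rule tendsto_within_subset) simp
qed

text \<open>
  The limit is the area of the spherical part plus the areas of the two faces. The faces are kept as
  discs orthogonal to \<open>w\<close> and to \<open>- w\<close>, because invariance under reflections is not among the
  properties of the measure in use.
\<close>

lemma surface_quotient_truncated_ball_tendsto:
  assumes w: "norm w = 1" "w \<in> E" and c: "0 < c" "c < 1"
  defines "\<rho> \<equiv> sqrt (1 - c\<^sup>2)"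
  shows "((\<lambda>t. (measure M (parallel_body U (truncated_ball E w c) t)
              - measure M (truncated_ball E w c)) / t)
          \<longlongrightarrow> real m * measure M (spherical_cone E w c 1) + (disc_area w \<rho> + disc_area (- w) \<rho>))
         (at_right 0)" (is "(?q \<longlongrightarrow> ?l) _")
proof -
  have mw: "norm (- w) = 1" "- w \<in> E" using w subspace by (auto simp: subspace_neg)
  have c2: "c\<^sup>2 < 1" using c by (simp add: power_less_one_iff)
  then have \<rho>: "\<rho> > 0" by (simp add: \<rho>_def)
  let ?a = "measure M (spherical_cone E w c 1)"
  let ?s = "\<lambda>t. sqrt ((1 + t)\<^sup>2 - c\<^sup>2)"
  let ?lo = "\<lambda>t. ((1 + t) ^ m - 1) / t * ?a + (disc_area w \<rho> + disc_area (- w) \<rho>)"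
  let ?hi = "\<lambda>t. ((1 + t) ^ m - 1) / t * ?a + (disc_area w (?s t) + disc_area (- w) (?s t))"
  have lo: "(?lo \<longlongrightarrow> ?l) (at_right 0)"
    by (intro tendsto_intros power_difference_quotient_tendsto)
  have s: "(?s \<longlongrightarrow> \<rho>) (at_right 0)"
    unfolding \<rho>_def by (auto intro!: tendsto_eq_intros)
  have disc: "((\<lambda>t. disc_area v (?s t)) \<longlongrightarrow> disc_area v \<rho>) (at_right 0)"
    if v: "norm v = 1" "v \<in> E" for v
  proof -
    have "((\<lambda>t. ?s t ^ m / ?s t * disc_area v 1) \<longlongrightarrow> \<rho> ^ m / \<rho> * disc_area v 1) (at_right 0)"
      using s \<rho> by (intro tendsto_intros) auto
    moreover have "eventually (\<lambda>t. ?s t ^ m / ?s t * disc_area v 1 = disc_area v (?s t)) (at_right 0)"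
      using order_tendstoD(1)[OF s \<rho>]
      by (rule eventually_mono) (rule disc_area_scale[OF v, symmetric])
    ultimately show ?thesis
      unfolding disc_area_scale[OF v \<rho>] by (rule Lim_transform_eventually)
  qed
  have hi: "(?hi \<longlongrightarrow> ?l) (at_right 0)"
    by (intro tendsto_intros power_difference_quotient_tendsto disc w mw)
  have bounds: "?lo t \<le> ?q t \<and> ?q t \<le> ?hi t" if "t > 0" for t
  proof -
    have "((1 + t) ^ m - 1) / t * ?a + d = (((1 + t) ^ m - 1) * ?a + t * d) / t" for d
      using that by (simp add: add_divide_distrib)
    then show ?thesis
      using measure_parallel_truncated_ball_bounds[OF w c that] that
      unfolding \<rho>_def by (simp only: divide_right_mono less_imp_le simp_thms)
  qed
  have pos: "eventually (\<lambda>t::real. t > 0) (at_right 0)" by (rule eventually_at_right_less)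
  show ?thesis
    using eventually_mono[OF pos, of "\<lambda>t. ?lo t \<le> ?q t"]
      eventually_mono[OF pos, of "\<lambda>t. ?q t \<le> ?hi t"] bounds
    by (intro tendsto_sandwich[OF _ _ lo hi]) blast+
qed

lemma surface_area_truncated_ball:
  assumes "norm w = 1" "w \<in> E" "0 < c" "c < 1"
  shows "surface_area_wrt M U (truncated_ball E w c)
       = real m * measure M (spherical_cone E w c 1)
         + (disc_area w (sqrt (1 - c\<^sup>2)) + disc_area (- w) (sqrt (1 - c\<^sup>2)))"
  using surface_quotient_truncated_ball_tendsto[OF assms]
  unfolding surface_area_wrt_def parallel_body_def by (intro tendsto_Lim) auto

section \<open>Truncation does not increase the surface area\<close>

lemma parallel_body_ball:
  assumes "t > 0"
  shows "parallel_body U U t = (*\<^sub>R) (1 + t) ` U"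
proof (intro equalityI subsetI)
  fix x assume "x \<in> parallel_body U U t"
  then obtain a u where au: "x = a + t *\<^sub>R u" "a \<in> U" "u \<in> U" by (auto simp: parallel_body_def)
  have "norm x \<le> norm a + t * norm u"
    using au(1) norm_triangle_ineq[of a "t *\<^sub>R u"] assms by simp
  also have "\<dots> \<le> 1 + t" using au assms by (intro add_mono) (auto simp: mult_left_le)
  finally have "norm x \<le> 1 + t" .
  then have "(1 / (1 + t)) *\<^sub>R x \<in> U"
    using au assms subspace by (auto simp: subspace_add subspace_scale)
  then show "x \<in> (*\<^sub>R) (1 + t) ` U"
    using assms by (intro image_eqI[where x = "(1 / (1 + t)) *\<^sub>R x"]) auto
next
  fix x assume "x \<in> (*\<^sub>R) (1 + t) ` U"
  then obtain u where "u \<in> U" "x = u + t *\<^sub>R u" by (auto simp: algebra_simps)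
  then show "x \<in> parallel_body U U t" unfolding parallel_body_def by blast
qed

lemma U_fmeasurable: "U \<in> fmeasurable M"
  using compact_U by (intro bounded_fmeasurable) (auto intro: borel_compact compact_imp_bounded)

lemma measure_parallel_ball:
  assumes "t > 0"
  shows "measure M (parallel_body U U t) = (1 + t) ^ m * measure M U"
  using measure_scale[of "1 + t" U] assms unfolding parallel_body_ball[OF assms] by simp

lemma surface_quotient_ball_tendsto:
  "((\<lambda>t. (measure M (parallel_body U U t) - measure M U) / t) \<longlongrightarrow> real m * measure M U) (at_right 0)"
proof (rule Lim_transform_eventually)
  show "((\<lambda>t. ((1 + t) ^ m - 1) / t * measure M U) \<longlongrightarrow> real m * measure M U) (at_right 0)"
    by (intro tendsto_intros power_difference_quotient_tendsto)
  show "eventually (\<lambda>t. ((1 + t) ^ m - 1) / t * measure M U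
      = (measure M (parallel_body U U t) - measure M U) / t) (at_right 0)"
    using eventually_at_right_less
  proof (rule eventually_mono)
    fix t :: real assume "0 < t"
    show "((1 + t) ^ m - 1) / t * measure M U = (measure M (parallel_body U U t) - measure M U) / t"
      unfolding measure_parallel_ball[OF \<open>0 < t\<close>] by (simp add: left_diff_distrib)
  qed
qed

lemma surface_area_ball: "surface_area_wrt M U U = real m * measure M U"
  using surface_quotient_ball_tendsto
  unfolding surface_area_wrt_def parallel_body_def by (intro tendsto_Lim) auto

text \<open>
  The ball is the disjoint union of the truncated ball and two caps. Moved outwards by \<open>t\<close> along their
  axis, the caps stay disjoint, lie beyond the height \<open>c + t\<close> that the parallel body of the truncated
  ball reaches, and remain in the ball of radius \<open>1 + t\<close>.
\<close>

lemma parallel_increment_truncated_le_ball: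
  assumes w: "norm w = 1" "w \<in> E" and c: "0 < c" and t: "t > 0"
  shows "measure M (parallel_body U (truncated_ball E w c) t) - measure M (truncated_ball E w c)
       \<le> measure M (parallel_body U U t) - measure M U"
proof -
  let ?A = "truncated_ball E w c" and ?P = "parallel_body U (truncated_ball E w c) t"
  let ?cap = "\<lambda>v. {x \<in> U. c < x \<bullet> v}"
  have mw: "norm (- w) = 1" "- w \<in> E" using w subspace by (auto simp: subspace_neg)
  have capB: "?cap v \<in> sets borel" for v
  proof -
    have "?cap v = U \<inter> {x. c < x \<bullet> v}" by blast
    then show ?thesis
      using closed_subspace[OF subspace] open_halfspace_gt[of c v] by (simp add: inner_commute)
  qed
  have capM: "?cap v \<in> fmeasurable M" for v
    by (intro bounded_fmeasurable capB bounded_subset[OF bounded_cball[of 0 1]]) auto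
  have shB: "(+) (t *\<^sub>R v) ` ?cap v \<in> sets borel" for v
    using affine_image_borel[of 1 "?cap v" "t *\<^sub>R v"] capB by simp
  have in_ball: "(+) (t *\<^sub>R v) ` ?cap v \<subseteq> parallel_body U U t" if "norm v = 1" "v \<in> E" for v
  proof
    fix x assume "x \<in> (+) (t *\<^sub>R v) ` ?cap v"
    then obtain y where "y \<in> U" "x = y + t *\<^sub>R v" by auto
    moreover have "v \<in> U" using that by simp
    ultimately show "x \<in> parallel_body U U t" unfolding parallel_body_def by blast
  qed
  have off: "?P \<inter> (+) (t *\<^sub>R v) ` ?cap v = {}" "\<And>x. x \<in> (+) (t *\<^sub>R v) ` ?cap v \<Longrightarrow> 0 < x \<bullet> v"
    if v: "norm v = 1" "truncated_ball E v c = ?A" for v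
  proof -
    have vv: "v \<bullet> v = 1" using v(1) by (simp add: norm_eq_sqrt_inner)
    have below: "x \<bullet> v \<le> c + t" if xP: "x \<in> ?P" for x
    proof -
      obtain a u where au: "x = a + t *\<^sub>R u" "a \<in> truncated_ball E v c" "u \<in> U"
        using xP unfolding parallel_body_def v(2)[symmetric] by blast
      have "u \<bullet> v \<le> 1"
        using norm_cauchy_schwarz[of u v] au(3) v(1) by simp
      then have "t * (u \<bullet> v) \<le> t * 1" using t by (intro mult_left_mono) simp_all
      moreover have "a \<bullet> v \<le> c" using au(2) by (auto simp: truncated_ball_def)
      ultimately show ?thesis by (simp add: au(1) inner_add_left)
    qed
    have above: "c + t < x \<bullet> v" if xC: "x \<in> (+) (t *\<^sub>R v) ` ?cap v" for x
    proof -
      obtain y where "c < y \<bullet> v" "x = t *\<^sub>R v + y" using xC by blast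
      then show ?thesis by (simp add: inner_add_left vv)
    qed
    show "?P \<inter> (+) (t *\<^sub>R v) ` ?cap v = {}"
    proof (rule Int_emptyI)
      fix x assume "x \<in> ?P" "x \<in> (+) (t *\<^sub>R v) ` ?cap v"
      then show False using below[of x] above[of x] by linarith
    qed
    show "0 < x \<bullet> v" if "x \<in> (+) (t *\<^sub>R v) ` ?cap v" for x
      using above[OF that] c t by linarith
  qed
  have P: "?P \<in> fmeasurable M" by (intro parallel_body_fmeasurable compact_truncated_ball)
  have PU: "parallel_body U U t \<in> fmeasurable M" by (intro parallel_body_fmeasurable compact_U)
  have tA: "truncated_ball E (- w) c = ?A" by (auto simp: truncated_ball_def)
  let ?X = "(+) (t *\<^sub>R w) ` ?cap w" and ?Y = "(+) (t *\<^sub>R (- w)) ` ?cap (- w)"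
  have X: "?X \<in> fmeasurable M" and Y: "?Y \<in> fmeasurable M"
    by (rule fmeasurableI2[OF PU in_ball[OF w]], simp only: sets_eq shB)
      (rule fmeasurableI2[OF PU in_ball[OF mw]], simp only: sets_eq shB)
  have "?X \<inter> ?Y = {}"
  proof (rule Int_emptyI)
    fix x assume "x \<in> ?X" "x \<in> ?Y"
    then have "0 < x \<bullet> w" "0 < x \<bullet> (- w)"
      using off(2)[OF w(1) refl] off(2)[OF mw(1) tA] by blast+
    then show False by simp
  qed
  then have "(?P \<union> ?X) \<inter> ?Y = {}"
    using off(1)[OF mw(1) tA] by blast
  then have "measure M (?P \<union> ?X \<union> ?Y) = measure M ?P + measure M ?X + measure M ?Y"
    using measure_Un_disjoint[OF fmeasurable.Un[OF P X] Y]
      measure_Un_disjoint[OF P X off(1)[OF w(1) refl]] by linarith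
  moreover have "measure M ?X = measure M (?cap w)" "measure M ?Y = measure M (?cap (- w))"
    by (intro measure_translation capB subspace_scale subspace w mw)+
  moreover have "?P \<subseteq> parallel_body U U t"
    by (auto simp: parallel_body_def truncated_ball_def)
  then have "measure M (?P \<union> ?X \<union> ?Y) \<le> measure M (parallel_body U U t)"
    using in_ball[OF w] in_ball[OF mw]
    by (intro measure_mono_fmeasurable PU Un_least fmeasurableD fmeasurable.Un P X Y)
  moreover have "measure M U = measure M ?A + measure M (?cap w) + measure M (?cap (- w))"
  proof -
    have split: "U = ?A \<union> ?cap w \<union> ?cap (- w)"
      by (auto simp: truncated_ball_def)
    have disj: "?A \<inter> ?cap w = {}" "(?A \<union> ?cap w) \<inter> ?cap (- w) = {}"
      using c by (auto simp: truncated_ball_def)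
    have "measure M (?A \<union> ?cap w \<union> ?cap (- w)) = measure M ?A + measure M (?cap w) + measure M (?cap (- w))"
      using measure_Un_disjoint[OF fmeasurable.Un[OF truncated_ball_fmeasurable capM] capM disj(2)]
        measure_Un_disjoint[OF truncated_ball_fmeasurable capM disj(1)] by linarith
    then show ?thesis using arg_cong[OF split, of "measure M"] by linarith
  qed
  ultimately show ?thesis by linarith
qed

lemma surface_area_truncated_ball_le_ball:
  assumes w: "norm w = 1" "w \<in> E" and c: "0 < c" "c < 1"
  shows "surface_area_wrt M U (truncated_ball E w c) \<le> surface_area_wrt M U U"
  unfolding surface_area_truncated_ball[OF w c] surface_area_ball
proof (rule tendsto_le[OF _ surface_quotient_ball_tendsto surface_quotient_truncated_ball_tendsto[OF w c]])
  show "eventually (\<lambda>t. (measure M (parallel_body U (truncated_ball E w c) t)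
        - measure M (truncated_ball E w c)) / t
      \<le> (measure M (parallel_body U U t) - measure M U) / t) (at_right 0)"
    using eventually_at_right_less
    by (rule eventually_mono)
      (intro divide_right_mono parallel_increment_truncated_le_ball[OF w c(1)], auto)
qed simp

end

section \<open>Central sections of a truncated ball\<close>

lemma subspace_perp: "subspace (perp \<xi>)"
  unfolding perp_def using subspace_hyperplane[of \<xi>] by (simp add: inner_commute)

lemma dim_perp:
  fixes \<xi> :: "'a::euclidean_space"
  assumes "norm \<xi> = 1"
  shows "dim (perp \<xi>) = DIM('a) - 1"
proof -
  have "\<xi> \<noteq> 0" using assms by auto
  then show ?thesis
    using dim_hyperplane[of \<xi>] unfolding perp_def by (simp add: inner_commute)
qed

lemma surface_area_in_unit_ball:
  fixes E :: "'a::euclidean_space set"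
  assumes "subspace E"
  shows "surface_area_in E (cball 0 1 \<inter> E) = real (dim E) * unit_ball_vol (real (dim E))"
proof -
  interpret subspace_volume "lborel_of E" E "dim E"
    using assms by (rule subspace_volume_lborel_of)
  show ?thesis
    using surface_area_ball by (simp add: surface_area_in_def measure_lborel_of_unit_ball[OF assms])
qed

text \<open>
  On \<open>perp \<xi>\<close> the functional \<open>x \<mapsto> x \<bullet> e\<close> is represented by the orthogonal projection \<open>p\<close> of \<open>e\<close>. If
  \<open>norm p \<le> \<epsilon>\<close>, the slab contains the unit ball of \<open>perp \<xi>\<close>; otherwise it truncates that ball in the
  direction of \<open>p\<close>, at height \<open>\<epsilon> / norm p < 1\<close>.
\<close>

lemma truncated_ball_section:
  fixes e \<xi> :: "'a::euclidean_space"
  assumes "norm \<xi> = 1" "0 < \<epsilon>"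
  obtains "truncated_ball UNIV e \<epsilon> \<inter> perp \<xi> = cball 0 1 \<inter> perp \<xi>"
  | w c where "norm w = 1" "w \<in> perp \<xi>" "0 < c" "c < 1"
      "truncated_ball UNIV e \<epsilon> \<inter> perp \<xi> = truncated_ball (perp \<xi>) w c"
proof -
  define p where "p = e - (e \<bullet> \<xi>) *\<^sub>R \<xi>"
  have "\<xi> \<bullet> \<xi> = 1" using assms(1) by (simp add: norm_eq_sqrt_inner)
  then have p: "p \<in> perp \<xi>" by (simp add: p_def perp_def inner_diff_left)
  have inner: "x \<bullet> e = x \<bullet> p" if "x \<in> perp \<xi>" for x
    using that by (simp add: p_def perp_def inner_diff_right)
  show thesis
  proof (cases "norm p \<le> \<epsilon>")
    case True
    have "\<bar>x \<bullet> e\<bar> \<le> \<epsilon>" if "x \<in> perp \<xi>" "norm x \<le> 1" for x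
    proof -
      have "\<bar>x \<bullet> p\<bar> \<le> norm x * norm p" by (rule Cauchy_Schwarz_ineq2)
      also have "\<dots> \<le> 1 * norm p" using that by (intro mult_right_mono) auto
      finally show ?thesis using True inner[OF that(1)] by simp
    qed
    then have "truncated_ball UNIV e \<epsilon> \<inter> perp \<xi> = cball 0 1 \<inter> perp \<xi>"
      by (auto simp: truncated_ball_def)
    then show thesis by (rule that(1))
  next
    case False
    then have pos: "norm p > 0" using assms(2) by linarith
    show thesis
    proof (rule that(2))
      show "norm ((1 / norm p) *\<^sub>R p) = 1" using pos by simp
      show "(1 / norm p) *\<^sub>R p \<in> perp \<xi>" 
        using p by (intro subspace_scale subspace_perp)
      show "0 < \<epsilon> / norm p" "\<epsilon> / norm p < 1" using pos False assms(2) by (simp_all add: divide_less_eq)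
      have "\<bar>x \<bullet> ((1 / norm p) *\<^sub>R p)\<bar> \<le> \<epsilon> / norm p \<longleftrightarrow> \<bar>x \<bullet> p\<bar> \<le> \<epsilon>" for x
        using pos by (simp add: abs_divide divide_le_cancel)
      then show "truncated_ball UNIV e \<epsilon> \<inter> perp \<xi>
          = truncated_ball (perp \<xi>) ((1 / norm p) *\<^sub>R p) (\<epsilon> / norm p)"
        using inner by (auto simp: truncated_ball_def)
    qed
  qed
qed

text \<open>
  The maximum is attained at \<open>\<xi> = e\<close>, where the section is the whole unit ball of the hyperplane.
\<close>

lemma max_section_surface_area_truncated_ball:
  fixes e :: "'a::euclidean_space"
  assumes e: "norm e = 1" and \<epsilon>: "0 < \<epsilon>"
  shows "max_section_surface_area (truncated_ball UNIV e \<epsilon>)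
       = real (DIM('a) - 1) * unit_ball_vol (real (DIM('a) - 1))" (is "_ = ?s")
  unfolding max_section_surface_area_def
proof (rule Greatest_equality)
  have "truncated_ball UNIV e \<epsilon> \<inter> perp e = cball 0 1 \<inter> perp e"
    using \<epsilon> by (auto simp: truncated_ball_def perp_def)
  then have "surface_area_in (perp e) (truncated_ball UNIV e \<epsilon> \<inter> perp e) = ?s"
    by (simp add: surface_area_in_unit_ball subspace_perp dim_perp[OF e])
  then show "?s \<in> (\<lambda>\<xi>. surface_area_in (perp \<xi>) (truncated_ball UNIV e \<epsilon> \<inter> perp \<xi>)) ` sphere 0 1"
    using e by (intro image_eqI[where x = e]) auto
next
  fix s
  assume "s \<in> (\<lambda>\<xi>. surface_area_in (perp \<xi>) (truncated_ball UNIV e \<epsilon> \<inter> perp \<xi>)) ` sphere 0 1"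
  then obtain \<xi> :: 'a where \<xi>: "norm \<xi> = 1"
    and s: "s = surface_area_in (perp \<xi>) (truncated_ball UNIV e \<epsilon> \<inter> perp \<xi>)" by auto
  have ball: "surface_area_in (perp \<xi>) (cball 0 1 \<inter> perp \<xi>) = ?s"
    by (simp add: surface_area_in_unit_ball subspace_perp dim_perp[OF \<xi>])
  interpret subspace_volume "lborel_of (perp \<xi>)" "perp \<xi>" "dim (perp \<xi>)"
    by (intro subspace_volume_lborel_of subspace_perp)
  from \<xi> \<epsilon> show "s \<le> ?s"
  proof (cases rule: truncated_ball_section[of \<xi> \<epsilon> e])
    case 1
    then show ?thesis using s ball by simp
  next
    case (2 w c)
    then show ?thesis
      using surface_area_truncated_ball_le_ball[of w c] ball s by (simp add: surface_area_in_def)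
  qed
qed

section \<open>Flat truncated balls\<close>

lemma symmetric_convex_body_truncated_ball:
  fixes e :: "'a::euclidean_space"
  assumes e: "norm e = 1" and \<epsilon>: "0 < \<epsilon>"
  shows "symmetric_convex_body (truncated_ball UNIV e \<epsilon>)"
proof -
  interpret subspace_volume "lborel :: 'a measure" UNIV "DIM('a)"
    by (rule subspace_volume_lborel)
  have eq: "truncated_ball UNIV e \<epsilon> = cball 0 1 \<inter> ({x. e \<bullet> x \<le> \<epsilon>} \<inter> {x. e \<bullet> x \<ge> - \<epsilon>})"
    by (auto simp: truncated_ball_def inner_commute)
  have "convex (truncated_ball UNIV e \<epsilon>)"
    unfolding eq by (intro convex_Int convex_cball convex_halfspace_le convex_halfspace_ge)
  moreover have "ball 0 (min 1 \<epsilon>) \<subseteq> truncated_ball UNIV e \<epsilon>"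
  proof
    fix x :: 'a assume "x \<in> ball 0 (min 1 \<epsilon>)"
    then show "x \<in> truncated_ball UNIV e \<epsilon>"
      using Cauchy_Schwarz_ineq2[of x e] e by (auto simp: truncated_ball_def)
  qed
  then have "0 \<in> interior (truncated_ball UNIV e \<epsilon>)"
    using \<epsilon> by (meson centre_in_ball interior_maximal open_ball subsetD min_less_iff_conj zero_less_one)
  ultimately show ?thesis
    using compact_truncated_ball by (auto simp: symmetric_convex_body_def truncated_ball_def)
qed

text \<open>
  One of the two faces is enough. For \<open>\<epsilon> \<le> 1 / 2\<close> its radius \<open>sqrt (1 - \<epsilon>\<^sup>2)\<close> is at least \<open>1 / 2\<close>, which
  makes the bound independent of \<open>\<epsilon>\<close>.
\<close>

lemma surface_area_truncated_ball_ge: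
  fixes e :: "'a::euclidean_space"
  assumes e: "norm e = 1" and \<epsilon>: "0 < \<epsilon>" "\<epsilon> \<le> 1 / 2"
  shows "measure lborel (cylinder UNIV e (1 / 2) 0 1) \<le> surface_area (truncated_ball UNIV e \<epsilon>)"
proof -
  interpret subspace_volume "lborel :: 'a measure" UNIV "DIM('a)"
    by (rule subspace_volume_lborel)
  have "\<epsilon>\<^sup>2 \<le> (1 / 2)\<^sup>2" using \<epsilon> by (intro power_mono) auto
  then have "1 / 2 \<le> sqrt (1 - \<epsilon>\<^sup>2)" by (intro real_le_rsqrt) (simp add: power2_eq_square)
  then have "disc_area e (1 / 2) \<le> disc_area e (sqrt (1 - \<epsilon>\<^sup>2))"
    using e by (intro disc_area_mono)
  moreover have "0 \<le> real DIM('a) * measure lborel (spherical_cone UNIV e \<epsilon> 1)"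
    "0 \<le> disc_area (- e) (sqrt (1 - \<epsilon>\<^sup>2))"
    by (simp_all add: disc_area_nonneg)
  moreover have "surface_area (truncated_ball UNIV e \<epsilon>)
      = real DIM('a) * measure lborel (spherical_cone UNIV e \<epsilon> 1)
        + (disc_area e (sqrt (1 - \<epsilon>\<^sup>2)) + disc_area (- e) (sqrt (1 - \<epsilon>\<^sup>2)))"
    using surface_area_truncated_ball[of e \<epsilon>] e \<epsilon> by (simp add: surface_area_def)
  ultimately show ?thesis unfolding disc_area_def[of e "1 / 2", symmetric] by linarith
qed

lemma measure_truncated_ball_le:
  fixes e :: "'a::euclidean_space"
  assumes e: "norm e = 1" and \<epsilon>: "0 < \<epsilon>"
  shows "measure lborel (truncated_ball UNIV e \<epsilon>)
       \<le> 3 * \<epsilon> * measure lborel (cylinder UNIV e 1 0 1)"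
proof -
  interpret subspace_volume "lborel :: 'a measure" UNIV "DIM('a)"
    by (rule subspace_volume_lborel)
  \<comment> \<open>The cylinder is open at its lower end, so it has to start below \<open>- \<epsilon>\<close>.\<close>
  have "truncated_ball UNIV e \<epsilon> \<subseteq> cylinder UNIV e 1 (- 2 * \<epsilon>) \<epsilon>"
  proof
    fix x assume x: "x \<in> truncated_ball UNIV e \<epsilon>"
    show "x \<in> cylinder UNIV e 1 (- 2 * \<epsilon>) \<epsilon>"
      using x \<epsilon> norm_orthogonal_part_le[OF e, of x] by (auto simp: truncated_ball_def cylinder_def)
  qed
  then have "measure lborel (truncated_ball UNIV e \<epsilon>) \<le> measure lborel (cylinder UNIV e 1 (- 2 * \<epsilon>) \<epsilon>)"
    by (intro measure_mono_fmeasurable cylinder_fmeasurable e) auto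
  also have "\<dots> = 3 * \<epsilon> * measure lborel (cylinder UNIV e 1 0 1)"
    using measure_cylinder[of e "- 2 * \<epsilon>" \<epsilon> 1] e \<epsilon> by (simp add: disc_area_def)
  finally show ?thesis .
qed

lemma measure_cylinder_pos:
  fixes e :: "'a::euclidean_space"
  assumes e: "norm e = 1" and r: "r > 0"
  shows "0 < measure lborel (cylinder UNIV e r 0 1)"
proof -
  interpret subspace_volume "lborel :: 'a measure" UNIV "DIM('a)"
    by (rule subspace_volume_lborel)
  have ee: "e \<bullet> e = 1" using e by (simp add: norm_eq_sqrt_inner)
  have "ball ((1 / 2) *\<^sub>R e) (min (1 / 2) r) \<subseteq> cylinder UNIV e r 0 1"
  proof
    fix x assume x: "x \<in> ball ((1 / 2) *\<^sub>R e) (min (1 / 2) r)"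
    define z where "z = x - (1 / 2) *\<^sub>R e"
    have nz: "norm z < 1 / 2" "norm z < r" using x by (simp_all add: z_def dist_norm norm_minus_commute)
    have "\<bar>z \<bullet> e\<bar> < 1 / 2" using nz(1) Cauchy_Schwarz_ineq2[of z e] e by simp
    then have "- (1 / 2) < z \<bullet> e \<and> z \<bullet> e < 1 / 2" by linarith
    moreover have "x \<bullet> e = z \<bullet> e + 1 / 2" by (simp add: z_def inner_diff_left ee)
    moreover have "x - (x \<bullet> e) *\<^sub>R e = z - (z \<bullet> e) *\<^sub>R e"
      by (simp add: z_def inner_diff_left ee algebra_simps)
    moreover have "norm (z - (z \<bullet> e) *\<^sub>R e) \<le> norm z"
      using e by (rule norm_orthogonal_part_le)
    ultimately show "x \<in> cylinder UNIV e r 0 1"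
      using nz r by (auto simp: cylinder_def)
  qed
  then have "measure lborel (ball ((1 / 2) *\<^sub>R e) (min (1 / 2) r)) \<le> measure lborel (cylinder UNIV e r 0 1)"
    by (intro measure_mono_fmeasurable cylinder_fmeasurable e) auto
  moreover have "0 < measure lborel (ball ((1 / 2) *\<^sub>R e) (min (1 / 2) r))"
    using r by (intro content_ball_pos) simp
  ultimately show ?thesis by linarith
qed

lemma symmetric_convex_body_measure_pos:
  assumes "symmetric_convex_body K"
  shows "0 < measure lborel K"
proof -
  obtain x r where "r > 0" "ball x r \<subseteq> K"
    using assms by (auto simp: symmetric_convex_body_def mem_interior)
  moreover have "K \<in> fmeasurable lborel"
    using assms fmeasurable_compact by (auto simp: symmetric_convex_body_def)
  ultimately have "measure lborel (ball x r) \<le> measure lborel K" "0 < measure lborel (ball x r)"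
    by (auto intro!: measure_mono_fmeasurable content_ball_pos)
  then show ?thesis by linarith
qed

theorem theorem1p1:
  assumes "CARD('n::finite) \<ge> 2"
  shows "(SUP K \<in> {K :: (real ^ 'n) set. symmetric_convex_body K}.
            ereal (surface_area K /
              (measure lborel K powr (1 / real CARD('n)) * max_section_surface_area K))) = \<infinity>"
proof (rule SUP_PInfty)
  fix N :: nat
  let ?n = "CARD('n)"
  obtain e :: "real ^ 'n" where e: "norm e = 1"
    by (metis vector_choose_size zero_le_one)
  define g G D where "g = measure lborel (cylinder UNIV e (1 / 2) 0 1)"
    and "G = measure lborel (cylinder UNIV e 1 0 1)"
    and "D = real (?n - 1) * unit_ball_vol (real (?n - 1))"
  have g: "g > 0" and G: "G > 0"
    unfolding g_def G_def using e by (auto intro!: measure_cylinder_pos)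
  have D: "D > 0" unfolding D_def using assms by (intro mult_pos_pos unit_ball_vol_pos) auto
  \<comment> \<open>It suffices that the \<open>n\<close>-th root of the volume is at most \<open>\<delta>\<close>, as \<open>g / (\<delta> * D) = N + 1\<close>.\<close>
  define \<delta> where "\<delta> = g / (D * (real N + 1))"
  have \<delta>: "\<delta> > 0" using g D by (simp add: \<delta>_def)
  define \<epsilon> where "\<epsilon> = min (1 / 2) (\<delta> ^ ?n / (3 * G))"
  have \<epsilon>: "0 < \<epsilon>" "\<epsilon> \<le> 1 / 2" "3 * \<epsilon> * G \<le> \<delta> ^ ?n"
    using \<delta> G by (auto simp: \<epsilon>_def min_def field_simps)
  let ?K = "truncated_ball UNIV e \<epsilon>"
  have K: "symmetric_convex_body ?K" using e \<epsilon>(1) by (rule symmetric_convex_body_truncated_ball)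
  have V: "0 < measure lborel ?K" using K by (rule symmetric_convex_body_measure_pos)
  have "measure lborel ?K \<le> \<delta> ^ ?n"
    using measure_truncated_ball_le[OF e \<epsilon>(1)] \<epsilon>(3) by (simp add: G_def)
  then have "measure lborel ?K powr (1 / real ?n) \<le> (\<delta> ^ ?n) powr (1 / real ?n)"
    using V by (intro powr_mono2) auto
  also have "\<dots> = \<delta>"
    using \<delta> by (simp add: powr_realpow[symmetric] powr_powr)
  finally have root: "measure lborel ?K powr (1 / real ?n) \<le> \<delta>" .
  have max: "max_section_surface_area ?K = D"
    using max_section_surface_area_truncated_ball[OF e \<epsilon>(1)] by (simp add: D_def)
  have "real N \<le> g / (\<delta> * D)"
    using g D by (simp add: \<delta>_def)
  also have "\<dots> \<le> surface_area ?K / (measure lborel ?K powr (1 / real ?n) * D)"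
    using surface_area_truncated_ball_ge[OF e \<epsilon>(1,2)] root g D V
    by (intro frac_le mult_right_mono) (auto simp: g_def)
  finally show "\<exists>K\<in>{K :: (real ^ 'n) set. symmetric_convex_body K}.
      ereal (real N) \<le> ereal (surface_area K /
        (measure lborel K powr (1 / real ?n) * max_section_surface_area K))"
    using K max by (intro bexI[of _ ?K]) auto
qed

end
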